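(* Let $k<n$ be positive integers and let $d:[k]\to[n]$ be a strictly increasing function with $d_1>1$ and $d_k=n$. Let $d^*:[n-k]\to[n]$ be its Wei dual. The following are equivalent: (a) $d$ is subadditive and $d_r+d_k\le d_a+d_b$ for all $r,a,b\in[k]$ such that $r+k=a+b$. (b) $d$ is subadditive and cosubadditive. (c) $d^*$ is subadditive and cosubadditive. (d) $\alpha_s(d)=qd_k+d_r$ for all $s=kq+r\in\mathbb{N}$ with $r\in[k]$ and $q\in\mathbb{Z}_{\ge0}$. (e) $\alpha_s(d^* )=qd^*_{n-k}+d^*_r$ for all $s=(n-k)q+r\in\mathbb{N}$ with $r\in[n-k]$ and $q\in\mathbb{Z}_{\ge0}$.
   Context: $[m]=\{1,\dots,m\}$ and $d_i=d(i)$. A function $e:[m]\to[n]$ is subadditive if $e_{i+j}\le e_i+e_j$ whenever $i,j,i+j\in[m]$. For a strictly increasing $d:[k]\to[n]$ with $n>k$, the Wei dual $d^*:[n-k]\to[n]$ is the function such that $d^*_i$ is the $i$-th element, in increasing order, of $[n]\setminus\{n+1-d_j : j\in[k]\}$. The function $d$ is cosubadditive if $d^*$ is subadditive. For $e:[m]\to[n]$, the initial degree sequence is $\alpha_s(e)=\min\{\sum_{i=1}^m e_ib_i : b_i\in\mathbb{Z}_{\ge0},\ \sum_{i=1}^m ib_i=s\}$ for $s\in\mathbb{N}=\{1,2,\dots\}$. *)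

theory Defs
  imports Main "HOL-Library.FuncSet"
begin

text \<open>A function \<open>e : [m] \<rightarrow> [n]\<close> is represented by \<open>e :: nat \<Rightarrow> nat\<close> together with \<open>m\<close> (and \<open>n\<close>);
  only the values on \<open>{1..m}\<close> are used.\<close>

definition subadditive :: "nat \<Rightarrow> (nat \<Rightarrow> nat) \<Rightarrow> bool" where
  "subadditive m e \<longleftrightarrow> (\<forall>i\<in>{1..m}. \<forall>j\<in>{1..m}. i + j \<in> {1..m} \<longrightarrow> e (i + j) \<le> e i + e j)"

text \<open>List indices start at 0, so the \<open>i\<close>-th smallest element has index \<open>i - 1\<close>.
  If \<open>d : [k] \<rightarrow> [n]\<close> is strictly increasing, the values for \<open>i \<in> {1..n - k}\<close> are the meaningful ones.\<close>

definition wei_dual :: "nat \<Rightarrow> nat \<Rightarrow> (nat \<Rightarrow> nat) \<Rightarrow> nat \<Rightarrow> nat" where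
  "wei_dual k n d i = sorted_list_of_set ({1..n} - {n + 1 - d j | j. j \<in> {1..k}}) ! (i - 1)"

definition cosubadditive :: "nat \<Rightarrow> nat \<Rightarrow> (nat \<Rightarrow> nat) \<Rightarrow> bool" where
  "cosubadditive k n d \<longleftrightarrow> subadditive (n - k) (wei_dual k n d)"

text \<open>For \<open>m \<ge> 1\<close> the minimum exists, since \<open>b\<^sub>1 = s\<close> and \<open>b\<^sub>i = 0\<close> otherwise is admissible.\<close>

definition init_deg :: "nat \<Rightarrow> (nat \<Rightarrow> nat) \<Rightarrow> nat \<Rightarrow> nat" where
  "init_deg m e s =
     (LEAST v. \<exists>b :: nat \<Rightarrow> nat. v = (\<Sum>i=1..m. e i * b i) \<and> (\<Sum>i=1..m. i * b i) = s)"

end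

theory Submission
  imports Defs
begin

text \<open>Let \<open>c x\<close> be the number of values of \<open>d\<close> that are at most \<open>x\<close>, extended to all integers by
  \<open>c (x + n) = c x + k\<close>. Since \<open>i \<le> c x\<close> iff \<open>d i \<le> x\<close>, subadditivity of the quasi-periodic
  extension of \<open>d\<close> is the same as superadditivity of \<open>c\<close>; the counting function of the Wei dual is
  \<open>x + c (- x)\<close>, which is superadditive exactly when \<open>c\<close> is. For \<open>x, y\<close> in \<open>{0..n}\<close>, the
  inequalities with \<open>x + y \<le> n\<close> express that \<open>d\<close> is subadditive, those with \<open>x + y \<ge> n\<close> that its
  dual is. Finally, the initial degree sequence is the largest subadditive function below \<open>d\<close>, so it
  equals the quasi-periodic extension iff the latter is subadditive.\<close>

section \<open>Counting functions and the effect of duality on their superadditivity\<close>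

definition count_le :: "nat \<Rightarrow> (nat \<Rightarrow> nat) \<Rightarrow> nat \<Rightarrow> nat" where
  "count_le k d x = card {i \<in> {1..k}. d i \<le> x}"

text \<open>Superadditivity of the extended counting function on \<open>{0..n}\<close>, without and with wrap-around.\<close>

definition superadd_low :: "nat \<Rightarrow> (nat \<Rightarrow> nat) \<Rightarrow> bool" where
  "superadd_low n c \<longleftrightarrow> (\<forall>x y. x + y \<le> n \<longrightarrow> c x + c y \<le> c (x + y))"

definition superadd_high :: "nat \<Rightarrow> nat \<Rightarrow> (nat \<Rightarrow> nat) \<Rightarrow> bool" where
  "superadd_high k n c \<longleftrightarrow>
     (\<forall>x y. x \<le> n \<longrightarrow> y \<le> n \<longrightarrow> n \<le> x + y \<longrightarrow> c x + c y \<le> c (x + y - n) + k)"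

definition wrap_subadditive :: "nat \<Rightarrow> (nat \<Rightarrow> nat) \<Rightarrow> bool" where
  "wrap_subadditive k d \<longleftrightarrow>
     (\<forall>r\<in>{1..k}. \<forall>a\<in>{1..k}. \<forall>b\<in>{1..k}. r + k = a + b \<longrightarrow> d r + d k \<le> d a + d b)"

text \<open>Substitute \<open>x = n - u\<close> and \<open>y = n - v\<close>. By
  \<open>dual\<close>, both counts differ from each other only by a linear term, and these terms
  cancel up to the constant \<open>k\<close> or \<open>n - k\<close>. The reflection turns sums at
  most \<open>n\<close> into sums at least \<open>n\<close>, so the two ranges are
  exchanged.\<close>

lemma superadd_dual_iff:
  assumes dual: "\<And>x. x \<le> n \<Longrightarrow> c' x + k = x + c (n - x)" and c_n: "c n = k" and "k \<le> n"
  shows "superadd_low n c' \<longleftrightarrow> superadd_high k n c"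
    and "superadd_high (n - k) n c' \<longleftrightarrow> superadd_low n c"
proof -
  have lift: "c u + c v \<le> c (u + v - n) + k \<longleftrightarrow> c' x + c' y \<le> c' (x + y)"
    if "x + y \<le> n" "u = n - x" "v = n - y" for x y u v
  proof -
    have "u + v - n = n - (x + y)" using that by simp
    then show ?thesis
      using dual[of x] dual[of y] dual[of "x + y"] that by simp linarith
  qed
  show "superadd_low n c' \<longleftrightarrow> superadd_high k n c"
  proof
    assume L: "superadd_low n c'"
    show "superadd_high k n c"
      unfolding superadd_high_def
    proof (intro allI impI)
      fix u v assume uv: "u \<le> n" "v \<le> n" "n \<le> u + v"
      then have le: "(n - u) + (n - v) \<le> n" by linarith
      then have "c' (n - u) + c' (n - v) \<le> c' ((n - u) + (n - v))"
        using L unfolding superadd_low_def by blast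
      then show "c u + c v \<le> c (u + v - n) + k"
        using lift[OF le, of u v] uv by linarith
    qed
  next
    assume H: "superadd_high k n c"
    show "superadd_low n c'"
      unfolding superadd_low_def
    proof (intro allI impI)
      fix x y assume xy: "x + y \<le> n"
      have "n - x \<le> n" "n - y \<le> n" "n \<le> n - x + (n - y)" using xy by linarith+
      then have "c (n - x) + c (n - y) \<le> c (n - x + (n - y) - n) + k"
        using H unfolding superadd_high_def by blast
      then show "c' x + c' y \<le> c' (x + y)"
        using lift[OF xy refl refl] by blast
    qed
  qed
  have lower: "c x + c y \<le> c (x + y) \<longleftrightarrow> c' u + c' v \<le> c' (u + v - n) + (n - k)"
    if "x + y \<le> n" "u = n - x" "v = n - y" for x y u v
  proof -
    have "u + v - n = n - (x + y)" using that by simp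
    then show ?thesis
      using dual[of u] dual[of v] dual[of "n - (x + y)"] that \<open>k \<le> n\<close> by simp linarith
  qed
  show "superadd_high (n - k) n c' \<longleftrightarrow> superadd_low n c"
  proof
    assume H: "superadd_high (n - k) n c'"
    show "superadd_low n c"
      unfolding superadd_low_def
    proof (intro allI impI)
      fix x y assume xy: "x + y \<le> n"
      have "n - x \<le> n" "n - y \<le> n" "n \<le> n - x + (n - y)" using xy by linarith+
      then have "c' (n - x) + c' (n - y) \<le> c' (n - x + (n - y) - n) + (n - k)"
        using H unfolding superadd_high_def by blast
      then show "c x + c y \<le> c (x + y)"
        using lower[OF xy refl refl] by blast
    qed
  next
    assume L: "superadd_low n c"
    show "superadd_high (n - k) n c'"
      unfolding superadd_high_def
    proof (intro allI impI)
      fix u v assume uv: "u \<le> n" "v \<le> n" "n \<le> u + v"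
      then have le: "(n - u) + (n - v) \<le> n" by linarith
      then have "c (n - u) + c (n - v) \<le> c ((n - u) + (n - v))"
        using L unfolding superadd_low_def by blast
      then show "c' u + c' v \<le> c' (u + v - n) + (n - k)"
        using lower[OF le, of u v] uv by linarith
    qed
  qed
qed

section \<open>Bounds for the initial degree sequence\<close>

lemma init_deg_le:
  assumes "(\<Sum>i=1..m. i * b i) = s"
  shows "init_deg m e s \<le> (\<Sum>i=1..m. e i * b i)"
  unfolding init_deg_def using assms by (intro Least_le) blast

lemma init_deg_attained:
  assumes "0 < m"
  obtains b where "init_deg m e s = (\<Sum>i=1..m. e i * b i)" "(\<Sum>i=1..m. i * b i) = s"
proof -
  define b where "b = (\<lambda>i::nat. if i = 1 then s else 0)"
  have "(\<Sum>i=1..m. i * b i) = (\<Sum>i=1..m. if i = 1 then s else 0)"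
    by (intro sum.cong) (auto simp: b_def)
  also have "\<dots> = s" using assms by simp
  finally have "\<exists>v b. v = (\<Sum>i=1..m. e i * b i) \<and> (\<Sum>i=1..m. i * b i) = s" by blast
  from LeastI_ex[OF this] show ?thesis
    using that unfolding init_deg_def by blast
qed

lemma init_deg_le_multiples:
  assumes "i \<in> {1..m}" "j \<in> {1..m}"
  shows "init_deg m e (i * p + j * q) \<le> e i * p + e j * q"
proof -
  \<comment> \<open>Adding two separate contributions also covers the case
    \<open>i = j\<close>.\<close>
  let ?b = "\<lambda>t. (if t = i then p else 0) + (if t = j then q else 0)"
  have *: "(\<Sum>t=1..m. f t * ?b t) = f i * p + f j * q" for f
    using assms by (simp add: distrib_left sum.distrib if_distrib[of "(*) _"] cong: if_cong)
  show ?thesis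
    using init_deg_le[of ?b m "i * p + j * q" e] *[of "\<lambda>t. t"] *[of e] by simp
qed

text \<open>These hypotheses are stable under Wei duality, with \<open>n - k\<close> in place of
  \<open>k\<close>, so every result below also applies to the dual by interpretation.\<close>

locale degree_sequence =
  fixes k n :: nat and d :: "nat \<Rightarrow> nat"
  assumes k_pos: "0 < k" and k_less: "k < n" and mono: "strict_mono_on {1..k} d"
    and d_1: "1 < d 1" and d_k: "d k = n"
begin

lemma d_less_iff: "i \<in> {1..k} \<Longrightarrow> j \<in> {1..k} \<Longrightarrow> d i < d j \<longleftrightarrow> i < j"
  using mono by (rule strict_mono_on_less)

lemma d_le_iff: "i \<in> {1..k} \<Longrightarrow> j \<in> {1..k} \<Longrightarrow> d i \<le> d j \<longleftrightarrow> i \<le> j"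
  using d_less_iff[of j i] by (simp add: linorder_not_less[symmetric])

lemma d_le_n: "i \<in> {1..k} \<Longrightarrow> d i \<le> n"
  using d_le_iff[of i k] k_pos d_k by simp

lemma d_gt_1: "i \<in> {1..k} \<Longrightarrow> 1 < d i"
  using d_le_iff[of 1 i] k_pos d_1 by simp

text \<open>Since \<open>d\<close> is increasing, the indices counted form an initial segment of
  \<open>{1..k}\<close>. This Galois connection translates inequalities between values of
  \<open>d\<close> into inequalities between counts.\<close>

lemma le_count_le_iff:
  assumes "i \<in> {1..k}"
  shows "i \<le> count_le k d x \<longleftrightarrow> d i \<le> x"
proof
  assume "d i \<le> x"
  then have "{1..i} \<subseteq> {j \<in> {1..k}. d j \<le> x}"
    using assms d_le_iff[of _ i] by fastforce
  from card_mono[OF _ this] show "i \<le> count_le k d x"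
    by (simp add: count_le_def)
next
  assume le: "i \<le> count_le k d x"
  show "d i \<le> x"
  proof (rule ccontr)
    assume "\<not> d i \<le> x"
    then have "{j \<in> {1..k}. d j \<le> x} \<subseteq> {1..<i}"
      using assms d_le_iff[of i] by fastforce
    from card_mono[OF _ this] have "count_le k d x \<le> i - 1"
      by (simp add: count_le_def)
    with le assms show False by auto
  qed
qed

lemma count_le_le: "count_le k d x \<le> k"
proof -
  have "card {i \<in> {1..k}. d i \<le> x} \<le> card {1..k}"
    by (rule card_mono) auto
  then show ?thesis by (simp add: count_le_def)
qed

lemma d_count_le: "0 < count_le k d x \<Longrightarrow> d (count_le k d x) \<le> x"
  using le_count_le_iff[of "count_le k d x" x] count_le_le[of x] by auto

lemma count_le_d: "i \<in> {1..k} \<Longrightarrow> count_le k d (d i) = i"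
  using le_count_le_iff[of i "d i"] d_count_le[of "d i"] count_le_le[of "d i"]
    d_le_iff[of "count_le k d (d i)" i] by auto

section \<open>Subadditivity conditions in terms of the counting function\<close>

lemma subadditive_iff_superadd_low:
  "subadditive k d \<longleftrightarrow> superadd_low n (count_le k d)"
proof
  assume sub: "subadditive k d"
  show "superadd_low n (count_le k d)"
    unfolding superadd_low_def
  proof (intro allI impI)
    fix x y assume xy: "x + y \<le> n"
    define i j where "i = count_le k d x" and "j = count_le k d y"
    have ij: "i \<le> k" "j \<le> k" using count_le_le by (auto simp: i_def j_def)
    show "i + j \<le> count_le k d (x + y)"
    \<comment> \<open>The index 0 lies outside the domain of \<open>d\<close>; there monotonicity of
      the count suffices.\<close>
    proof (cases "i = 0 \<or> j = 0")
      case True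
      have "count_le k d z \<le> count_le k d (x + y)" if "z \<le> x + y" for z
        unfolding count_le_def using that by (intro card_mono) auto
      then show ?thesis using True by (auto simp: i_def j_def)
    next
      case False
      then have d: "d i \<le> x" "d j \<le> y"
        using d_count_le by (auto simp: i_def j_def)
      have "i + j \<le> k"
      proof (rule ccontr)
        assume "\<not> i + j \<le> k"
        text \<open>Shrinking \<open>i\<close> to \<open>k - j\<close> strictly lowers \<open>d i + d j\<close>, yet it cannot drop below
          \<open>d k = n\<close>.\<close>
        show False
        \<comment> \<open>For \<open>j = k\<close> the index \<open>k - j\<close> would be 0.
          Instead, \<open>d k = n\<close> together with \<open>d i > 1\<close> already exceeds
          \<open>x + y \<le> n\<close>.\<close>
        proof (cases "j = k")
          case True
          then show False using d xy d_k d_gt_1[of i] False ij by auto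
        next
          case j: False
          then have "d (k - j) < d i"
            using d_less_iff[of "k - j" i] \<open>\<not> i + j \<le> k\<close> ij False by auto
          moreover have "d (k - j + j) \<le> d (k - j) + d j"
            using sub[unfolded subadditive_def, rule_format, of "k - j" j] j ij False by auto
          ultimately show False using d xy d_k ij by simp
        qed
      qed
      moreover have "d (i + j) \<le> d i + d j"
        using sub False ij \<open>i + j \<le> k\<close> unfolding subadditive_def by auto
      ultimately show ?thesis
        using le_count_le_iff[of "i + j" "x + y"] False d by auto
    qed
  qed
next
  assume L: "superadd_low n (count_le k d)"
  show "subadditive k d"
    unfolding subadditive_def
  proof (intro ballI impI)
    fix i j assume ij: "i \<in> {1..k}" "j \<in> {1..k}" "i + j \<in> {1..k}"
    show "d (i + j) \<le> d i + d j"
    proof (cases "d i + d j \<le> n")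
      case True
      then have "i + j \<le> count_le k d (d i + d j)"
        using L count_le_d ij unfolding superadd_low_def by metis
      then show ?thesis using le_count_le_iff ij by blast
    next
      case False
      then show ?thesis using d_le_n[OF ij(3)] by simp
    qed
  qed
qed

text \<open>In one direction the wrapped inequality is applied to the counts of \<open>x\<close> and
  \<open>y\<close>, with \<open>r\<close> the excess of their sum over \<open>k\<close>; in the
  other, \<open>x = d a\<close> and \<open>y = d b\<close>.\<close>

lemma wrap_subadditive_iff_superadd_high:
  assumes "subadditive k d"
  shows "wrap_subadditive k d \<longleftrightarrow> superadd_high k n (count_le k d)"
proof
  assume W: "wrap_subadditive k d"
  show "superadd_high k n (count_le k d)"
    unfolding superadd_high_def
  proof (intro allI impI)
    fix x y assume xy: "x \<le> n" "y \<le> n" "n \<le> x + y"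
    define i j where "i = count_le k d x" and "j = count_le k d y"
    have ij: "i \<le> k" "j \<le> k" using count_le_le by (auto simp: i_def j_def)
    show "i + j \<le> count_le k d (x + y - n) + k"
    proof (cases "i + j \<le> k")
      case False
      then have d: "d i \<le> x" "d j \<le> y"
        using d_count_le ij by (auto simp: i_def j_def)
      have mem: "i + j - k \<in> {1..k}" using False ij by auto
      then have "d (i + j - k) + d k \<le> d i + d j"
        using W[unfolded wrap_subadditive_def, rule_format, of "i + j - k" i j] False ij by auto
      then have "d (i + j - k) \<le> x + y - n" using d d_k by simp
      then show ?thesis
        using le_count_le_iff[OF mem, of "x + y - n"] by linarith
    qed simp
  qed
next
  assume H: "superadd_high k n (count_le k d)"
  show "wrap_subadditive k d"
    unfolding wrap_subadditive_def
  proof (intro ballI impI)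
    fix r a b assume rab: "r \<in> {1..k}" "a \<in> {1..k}" "b \<in> {1..k}" "r + k = a + b"
    \<comment> \<open>Only then does \<open>superadd_high\<close> apply. Otherwise subadditivity
      would force a count of at least \<open>a + b = r + k > k\<close>.\<close>
    have n: "n \<le> d a + d b"
    proof (rule ccontr)
      assume "\<not> n \<le> d a + d b"
      then have "a + b \<le> count_le k d (d a + d b)"
        using assms count_le_d rab unfolding subadditive_iff_superadd_low superadd_low_def
        by (metis linorder_le_cases)
      then show False using count_le_le[of "d a + d b"] rab by auto
    qed
    then have "a + b \<le> count_le k d (d a + d b - n) + k"
      using H count_le_d d_le_n rab unfolding superadd_high_def by metis
    then have "d r \<le> d a + d b - n"
      using le_count_le_iff[OF rab(1), of "d a + d b - n"] rab(4) by linarith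
    then show "d r + d k \<le> d a + d b" using n d_k by simp
  qed
qed

section \<open>The Wei dual and its counting function\<close>

lemma wei_dual_facts:
  defines "T \<equiv> {1..n} - {n + 1 - d j | j. j \<in> {1..k}}"
  shows wei_dual_image: "wei_dual k n d ` {1..n - k} = T"
    and strict_mono_wei_dual: "strict_mono_on {1..n - k} (wei_dual k n d)"
proof -
  have eq: "{n + 1 - d j | j. j \<in> {1..k}} = (\<lambda>j. n + 1 - d j) ` {1..k}" by blast
  have "inj_on d {1..k}" using mono by (rule strict_mono_on_imp_inj_on)
  \<comment> \<open>Truncated subtraction creates no collisions because
    \<open>d j \<le> n\<close>.\<close>
  then have "inj_on (\<lambda>j. n + 1 - d j) {1..k}"
    using d_le_n unfolding inj_on_def by (metis Suc_eq_plus1 diff_diff_cancel le_SucI)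
  moreover have "(\<lambda>j. n + 1 - d j) ` {1..k} \<subseteq> {1..n}"
    using d_le_n d_gt_1 by fastforce
  ultimately have card: "card T = n - k"
    unfolding T_def eq by (simp add: card_Diff_subset card_image)
  have len: "length (sorted_list_of_set T) = n - k" using card by simp
  have "finite T" by (simp add: T_def)
  have "wei_dual k n d ` {1..n - k} = (\<lambda>i. sorted_list_of_set T ! (i - 1)) ` Suc ` {..<n - k}"
    by (simp add: wei_dual_def[abs_def] T_def image_Suc_lessThan)
  also have "\<dots> = (!) (sorted_list_of_set T) ` {..<n - k}"
    by (simp add: image_image)
  also have "\<dots> = set (sorted_list_of_set T)"
    using len by (auto simp: set_conv_nth)
  also have "\<dots> = T" using \<open>finite T\<close> by simp
  finally show "wei_dual k n d ` {1..n - k} = T" .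
  show "strict_mono_on {1..n - k} (wei_dual k n d)"
  proof (rule strict_mono_onI)
    fix i j assume "i \<in> {1..n - k}" "j \<in> {1..n - k}" "i < j"
    then show "wei_dual k n d i < wei_dual k n d j"
      using sorted_wrt_nth_less[OF strict_sorted_list_of_set[of T], of "i - 1" "j - 1"] len
      by (simp add: wei_dual_def T_def)
  qed
qed

text \<open>The two boundary conditions swap: \<open>d 1 > 1\<close> means that \<open>n\<close> is
  not removed, so the last dual value is \<open>n\<close>; \<open>d k = n\<close> means that 1 is
  removed, so the first dual value exceeds 1.\<close>

lemma degree_sequence_wei_dual: "degree_sequence (n - k) n (wei_dual k n d)"
proof -
  let ?e = "wei_dual k n d"
  define T where "T = {1..n} - {n + 1 - d j | j. j \<in> {1..k}}"
  have img: "?e ` {1..n - k} = T" unfolding T_def by (rule wei_dual_image)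
  have "n \<in> T" using k_less d_gt_1 by (fastforce simp: T_def)
  then obtain i where i: "i \<in> {1..n - k}" "?e i = n" using img by force
  have "?e (n - k) \<in> T" using img k_less by force
  then have "?e (n - k) \<le> n" by (simp add: T_def)
  moreover have "i < n - k \<longrightarrow> ?e i < ?e (n - k)"
    using strict_mono_on_less[OF strict_mono_wei_dual, of i "n - k"] i by auto
  ultimately have "?e (n - k) = n" using i by (cases "i = n - k") auto
  moreover have "1 \<notin> T"
  proof -
    have "n + 1 - d k = 1" "k \<in> {1..k}" using d_k k_pos by simp_all
    then have "1 \<in> {n + 1 - d j | j. j \<in> {1..k}}" by (metis (mono_tags, lifting) mem_Collect_eq)
    then show ?thesis by (simp add: T_def)
  qed
  then have "1 < ?e 1"
  proof -
    have "?e 1 \<in> T" using img k_less by force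
    moreover have "0 \<notin> T" by (simp add: T_def)
    ultimately show ?thesis using \<open>1 \<notin> T\<close> by (metis less_one linorder_neqE_nat)
  qed
  ultimately show ?thesis
    using k_pos k_less strict_mono_wei_dual by unfold_locales auto
qed

text \<open>Among \<open>{1..x}\<close> exactly the elements \<open>n + 1 - d j\<close> with
  \<open>d j > n - x\<close> are missing from the dual, and there are
  \<open>k - count_le k d (n - x)\<close> of them.\<close>

lemma count_le_wei_dual:
  assumes "x \<le> n"
  shows "count_le (n - k) (wei_dual k n d) x + k = x + count_le k d (n - x)"
proof -
  let ?e = "wei_dual k n d" and ?f = "\<lambda>j. n + 1 - d j"
  define T where "T = {1..n} - {n + 1 - d j | j. j \<in> {1..k}}"
  define A where "A = {j \<in> {1..k}. n - x < d j}"
  have "inj_on ?e {1..n - k}"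
    using strict_mono_wei_dual by (rule strict_mono_on_imp_inj_on)
  then have "inj_on ?e {i \<in> {1..n - k}. ?e i \<le> x}" by (rule inj_on_subset) auto
  then have "count_le (n - k) ?e x = card (?e ` {i \<in> {1..n - k}. ?e i \<le> x})"
    by (simp add: count_le_def card_image)
  also have "?e ` {i \<in> {1..n - k}. ?e i \<le> x} = {t \<in> T. t \<le> x}"
    using wei_dual_image unfolding T_def[symmetric] by auto
  also have "\<dots> = {1..x} - ?f ` A"
    using assms by (auto simp: T_def A_def)
  finally have count: "count_le (n - k) ?e x = card ({1..x} - ?f ` A)" .
  have "inj_on d {1..k}" using mono by (rule strict_mono_on_imp_inj_on)
  then have "inj_on d A" by (rule inj_on_subset) (auto simp: A_def)
  then have inj: "inj_on ?f A"
    using d_le_n unfolding inj_on_def A_def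
    by (metis (no_types, lifting) Suc_eq_plus1 diff_diff_cancel le_SucI mem_Collect_eq)
  have sub: "?f ` A \<subseteq> {1..x}"
    using d_le_n assms by (fastforce simp: A_def)
  have cardA: "card A \<le> x"
    using card_mono[OF _ sub] inj by (simp add: card_image)
  have "finite A" by (simp add: A_def)
  then have "count_le (n - k) ?e x + card A = x"
    using count inj sub cardA by (simp add: card_Diff_subset card_image)
  moreover have "card {1..k} = card A + count_le k d (n - x)"
  proof -
    have "{1..k} = A \<union> {i \<in> {1..k}. d i \<le> n - x}" by (auto simp: A_def)
    then have "card {1..k} = card (A \<union> {i \<in> {1..k}. d i \<le> n - x})" by (rule arg_cong)
    also have "\<dots> = card A + card {i \<in> {1..k}. d i \<le> n - x}"
      by (rule card_Un_disjoint) (auto simp: A_def)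
    finally show ?thesis by (simp add: count_le_def)
  qed
  ultimately show ?thesis by simp
qed

lemma count_le_n: "count_le k d n = k"
  using count_le_d[of k] k_pos d_k by simp

lemma cosubadditive_iff_superadd_high:
  "cosubadditive k n d \<longleftrightarrow> superadd_high k n (count_le k d)"
proof -
  interpret dual: degree_sequence "n - k" n "wei_dual k n d"
    by (rule degree_sequence_wei_dual)
  show ?thesis
    unfolding cosubadditive_def dual.subadditive_iff_superadd_low
    using superadd_dual_iff(1)[OF count_le_wei_dual count_le_n] k_less by simp
qed

text \<open>Comparing counting functions gives this without identifying the double dual with
  \<open>d\<close>.\<close>

lemma cosubadditive_wei_dual_iff:
  "cosubadditive (n - k) n (wei_dual k n d) \<longleftrightarrow> subadditive k d"
proof -
  interpret dual: degree_sequence "n - k" n "wei_dual k n d"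
    by (rule degree_sequence_wei_dual)
  show ?thesis
    unfolding dual.cosubadditive_iff_superadd_high subadditive_iff_superadd_low
    using superadd_dual_iff(2)[OF count_le_wei_dual count_le_n] k_less by simp
qed

lemma wrap_subadditive_iff_cosubadditive:
  "subadditive k d \<Longrightarrow> wrap_subadditive k d \<longleftrightarrow> cosubadditive k n d"
  by (simp add: wrap_subadditive_iff_superadd_high cosubadditive_iff_superadd_high)

section \<open>The quasi-periodic extension and the initial degree sequence\<close>

definition quasi_periodic :: "nat \<Rightarrow> nat" where
  "quasi_periodic s = s div k * n + (if s mod k = 0 then 0 else d (s mod k))"

text \<open>Remainders here range over \<open>{1..k}\<close>, not \<open>{0..<k}\<close>; for
  \<open>r = k\<close> the two conventions agree because \<open>d k = n\<close>.\<close>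

lemma quasi_periodic_add: "r \<in> {1..k} \<Longrightarrow> quasi_periodic (k * q + r) = q * d k + d r"
  using k_pos d_k by (cases "r = k") (auto simp: quasi_periodic_def)

text \<open>Only the residues matter: without a carry, subadditivity of \<open>d\<close> suffices;
  with a carry, the extra period \<open>n = d k\<close> is paid for by the wrapped
  inequality.\<close>

lemma quasi_periodic_subadditive:
  assumes sub: "subadditive k d" and wrap: "wrap_subadditive k d"
  shows "quasi_periodic (s + t) \<le> quasi_periodic s + quasi_periodic t"
proof -
  define q r q' r' where "q = s div k" and "r = s mod k" and "q' = t div k" and "r' = t mod k"
  have s: "s = k * q + r" and t: "t = k * q' + r'"
    by (simp_all add: q_def r_def q'_def r'_def)
  have r: "r < k" "r' < k" using k_pos by (simp_all add: r_def r'_def)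
  have es: "quasi_periodic s = q * n + (if r = 0 then 0 else d r)"
    and et: "quasi_periodic t = q' * n + (if r' = 0 then 0 else d r')"
    by (simp_all add: quasi_periodic_def q_def r_def q'_def r'_def)
  consider "r = 0" | "r' = 0" | "0 < r" "0 < r'" "r + r' \<le> k" | "k < r + r'" by linarith
  then show ?thesis
  proof cases
    case 1
    then have "quasi_periodic (s + t) = (q + q') * n + (if r' = 0 then 0 else d r')"
      using r k_pos by (simp add: s t quasi_periodic_def)
    then show ?thesis using es et 1 by (simp add: algebra_simps)
  next
    case 2
    then have "s + t = k * (q + q') + r" by (simp add: s t algebra_simps)
    then have "quasi_periodic (s + t) = (q + q') * n + (if r = 0 then 0 else d r)"
      using r k_pos by (simp add: quasi_periodic_def)
    then show ?thesis using es et 2 by (simp add: algebra_simps)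
  next
    case 3
    have "s + t = k * (q + q') + (r + r')" by (simp add: s t algebra_simps)
    then have "quasi_periodic (s + t) = (q + q') * n + d (r + r')"
      using quasi_periodic_add[of "r + r'" "q + q'"] 3 d_k by simp
    moreover have "d (r + r') \<le> d r + d r'"
      using sub 3 r unfolding subadditive_def by auto
    ultimately show ?thesis using es et 3 by (simp add: algebra_simps)
  next
    case 4
    then have mem: "r + r' - k \<in> {1..k}" using r by auto
    have "s + t = k * (q + q' + 1) + (r + r' - k)" using 4 by (simp add: s t algebra_simps)
    then have "quasi_periodic (s + t) = (q + q' + 1) * n + d (r + r' - k)"
      using quasi_periodic_add[OF mem, of "q + q' + 1"] d_k by metis
    moreover have "d (r + r' - k) + n \<le> d r + d r'"
      using wrap[unfolded wrap_subadditive_def, rule_format, of "r + r' - k" r r'] 4 r d_k by auto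
    ultimately show ?thesis using es et 4 r by (simp add: algebra_simps)
  qed
qed

lemma init_deg_iff:
  "(\<forall>q. \<forall>r\<in>{1..k}. init_deg k d (k * q + r) = q * d k + d r) \<longleftrightarrow>
     subadditive k d \<and> cosubadditive k n d"
proof
  assume deg: "\<forall>q. \<forall>r\<in>{1..k}. init_deg k d (k * q + r) = q * d k + d r"
  have le: "init_deg k d (i + j) \<le> d i + d j" if "i \<in> {1..k}" "j \<in> {1..k}" for i j
    using init_deg_le_multiples[OF that, of d 1 1] by simp
  have "subadditive k d"
    unfolding subadditive_def
  proof (intro ballI impI)
    fix i j assume "i \<in> {1..k}" "j \<in> {1..k}" "i + j \<in> {1..k}"
    then show "d (i + j) \<le> d i + d j"
      \<comment> \<open>The quotient 0 gives plain subadditivity; the quotient 1 below gives the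
        wrapped inequality.\<close>
      using le[of i j] deg[rule_format, of "i + j" 0] by simp
  qed
  moreover have "wrap_subadditive k d"
    unfolding wrap_subadditive_def
  proof (intro ballI impI)
    fix r a b assume "r \<in> {1..k}" "a \<in> {1..k}" "b \<in> {1..k}" "r + k = a + b"
    then show "d r + d k \<le> d a + d b"
      using le[of a b] deg[rule_format, of r 1] by (simp add: add.commute)
  qed
  ultimately show "subadditive k d \<and> cosubadditive k n d"
    using wrap_subadditive_iff_cosubadditive by blast
next
  assume sc: "subadditive k d \<and> cosubadditive k n d"
  then have ext: "quasi_periodic (s + t) \<le> quasi_periodic s + quasi_periodic t" for s t
    using quasi_periodic_subadditive wrap_subadditive_iff_cosubadditive by blast
  have ext_0: "quasi_periodic 0 = 0" by (simp add: quasi_periodic_def)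
  have ext_mult: "quasi_periodic (i * p) \<le> quasi_periodic i * p" for i p
  proof (induction p)
    case (Suc p)
    then show ?case using ext[of i "i * p"] by simp
  qed (simp add: ext_0)
  have ext_sum: "quasi_periodic (\<Sum>i\<in>A. f i) \<le> (\<Sum>i\<in>A. quasi_periodic (f i))" if "finite A" for A and f :: "nat \<Rightarrow> nat"
    using that
  proof induction
    case (insert a A)
    then show ?case using ext[of "f a" "sum f A"] by simp
  qed (simp add: ext_0)
  show "\<forall>q. \<forall>r\<in>{1..k}. init_deg k d (k * q + r) = q * d k + d r"
  proof (intro allI ballI antisym)
    fix q r assume r: "r \<in> {1..k}"
    show "init_deg k d (k * q + r) \<le> q * d k + d r"
      \<comment> \<open>Upper bound: use \<open>q\<close> copies of \<open>k\<close> and one copy of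
        \<open>r\<close>.\<close>
      using init_deg_le_multiples[of k k r d q 1] r k_pos by (simp add: mult.commute)
    obtain b where b: "init_deg k d (k * q + r) = (\<Sum>i=1..k. d i * b i)"
      "(\<Sum>i=1..k. i * b i) = k * q + r"
      using init_deg_attained k_pos by blast
    \<comment> \<open>Lower bound: subadditivity of the extension, applied to an optimal
      decomposition.\<close>
    have "q * d k + d r = quasi_periodic (\<Sum>i=1..k. i * b i)"
      using b(2) quasi_periodic_add[OF r] by simp
    also have "\<dots> \<le> (\<Sum>i=1..k. quasi_periodic (i * b i))" by (rule ext_sum) simp
    also have "\<dots> \<le> (\<Sum>i=1..k. quasi_periodic i * b i)" by (rule sum_mono) (rule ext_mult)
    also have "\<dots> = (\<Sum>i=1..k. d i * b i)"
      using quasi_periodic_add[of _ 0] by (intro sum.cong) auto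
    finally show "q * d k + d r \<le> init_deg k d (k * q + r)" using b(1) by simp
  qed
qed

end

theorem corollary4p15:
  fixes k n :: nat and d dstar :: "nat \<Rightarrow> nat"
  assumes "0 < k" and "k < n"
    and "d \<in> {1..k} \<rightarrow> {1..n}"
    and "strict_mono_on {1..k} d"
    and "d 1 > 1" and "d k = n"
    and "dstar = wei_dual k n d"
  shows
    "((subadditive k d \<and>
        (\<forall>r\<in>{1..k}. \<forall>a\<in>{1..k}. \<forall>b\<in>{1..k}. r + k = a + b \<longrightarrow> d r + d k \<le> d a + d b))
      \<longleftrightarrow> (subadditive k d \<and> cosubadditive k n d)) \<and>
     ((subadditive k d \<and> cosubadditive k n d)
      \<longleftrightarrow> (subadditive (n - k) dstar \<and> cosubadditive (n - k) n dstar)) \<and>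
     ((subadditive k d \<and> cosubadditive k n d)
      \<longleftrightarrow> (\<forall>q. \<forall>r\<in>{1..k}. init_deg k d (k * q + r) = q * d k + d r)) \<and>
     ((subadditive k d \<and> cosubadditive k n d)
      \<longleftrightarrow> (\<forall>q. \<forall>r\<in>{1..n - k}.
             init_deg (n - k) dstar ((n - k) * q + r) = q * dstar (n - k) + dstar r))"
proof -
  interpret degree_sequence k n d
    using assms by unfold_locales auto
  interpret dual: degree_sequence "n - k" n dstar
    using degree_sequence_wei_dual assms(7) by simp
  \<comment> \<open>Passing to the dual exchanges subadditivity and cosubadditivity.\<close>
  have dual_iff: "subadditive k d \<and> cosubadditive k n d \<longleftrightarrow>
      subadditive (n - k) dstar \<and> cosubadditive (n - k) n dstar"
    using cosubadditive_wei_dual_iff assms(7) by (auto simp: cosubadditive_def)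
  show ?thesis
    \<comment> \<open>The degree conditions (d) and (e) become (b) and (c), by the same lemma for
      \<open>d\<close> and for its dual.\<close>
    unfolding wrap_subadditive_def[symmetric] init_deg_iff dual.init_deg_iff
    using dual_iff wrap_subadditive_iff_cosubadditive by blast
qed

end
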